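(* Let $G$ be a graph of minimum degree greater than or equal to two. The following assertions hold. (i) $\gamma_r(G)\le \gamma_{2,t}(G)$. (ii) For any graph $H$, $\gamma_{2,t}(G\circ H)\le \gamma_{2,t}(G)$. (iii) For any graph $H$, $\gamma_r(G\circ H)\le \gamma_{2,t}(G)$.
   Context: Graphs are finite, simple and undirected. For a graph $G$, a function $f:V(G)\to\{0,1,2\}$ has weight $w(f)=\sum_{v\in V(G)}f(v)$; a vertex $v$ is undefended with respect to $f$ if $f(v)=0$ and $f(u)=0$ for every $u$ adjacent to $v$. The function $f$ is a weak Roman dominating function (WRDF) on $G$ if for every $v$ with $f(v)=0$ there is a vertex $u$ adjacent to $v$ with $f(u)\in\{1,2\}$ such that the function $f'$ defined by $f'(v)=1$, $f'(u)=f(u)-1$ and $f'(z)=f(z)$ for $z\notin\{u,v\}$ has no undefended vertices. The weak Roman domination number $\gamma_r(G)$ is the minimum weight of a WRDF on $G$. The lexicographic product $G\circ H$ has vertex set $V(G)\times V(H)$, and $(u,v)$ and $(x,y)$ are adjacent iff $ux\in E(G)$, or $u=x$ and $vy\in E(H)$. For a graph $G$ of minimum degree at least two, a double total dominating set is a set $S\subseteq V(G)$ such that every vertex of $G$ is adjacent to at least two vertices of $S$; $\gamma_{2,t}(G)$ is the minimum cardinality of a double total dominating set. *)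

theory Defs
  imports "Graph_Theory.Pair_Digraph"
begin

text \<open>
  Finite simple undirected graphs are rendered by the locale predicate \<^const>\<open>pair_graph\<close>: finite,
  loop-free, and with a symmetric arc relation, so that an edge is represented by its two
  orientations and \<open>u \<rightarrow>\<^bsub>G\<^esub> v\<close> is adjacency.
\<close>

text \<open>
  By symmetry the out-degree of a vertex is its degree. The minimum degree of the null graph, which
  \<^const>\<open>pair_graph\<close> admits, is left unspecified.
\<close>

definition min_degree :: "'a pair_pre_digraph \<Rightarrow> nat" where
  "min_degree G = Min ((\<lambda>v. out_degree G v) ` pverts G)"

definition weight :: "'a pair_pre_digraph \<Rightarrow> ('a \<Rightarrow> nat) \<Rightarrow> nat" where
  "weight G f = (\<Sum>v\<in>pverts G. f v)"

definition undefended :: "'a pair_pre_digraph \<Rightarrow> ('a \<Rightarrow> nat) \<Rightarrow> 'a \<Rightarrow> bool" where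
  "undefended G f v \<longleftrightarrow> v \<in> pverts G \<and> f v = 0 \<and> (\<forall>u. v \<rightarrow>\<^bsub>G\<^esub> u \<longrightarrow> f u = 0)"

text \<open>
  Values of \<open>f\<close> outside the vertex set are unconstrained; neither the predicate nor the weight
  depends on them.
\<close>

definition weak_roman_dominating :: "'a pair_pre_digraph \<Rightarrow> ('a \<Rightarrow> nat) \<Rightarrow> bool" where
  "weak_roman_dominating G f \<longleftrightarrow>
     f \<in> pverts G \<rightarrow> {0, 1, 2} \<and>
     (\<forall>v\<in>pverts G. f v = 0 \<longrightarrow>
       (\<exists>u. v \<rightarrow>\<^bsub>G\<^esub> u \<and> f u \<in> {1, 2} \<and>
            (\<nexists>z. undefended G (f(v := 1, u := f u - 1)) z)))"

definition weak_roman_domination_number :: "'a pair_pre_digraph \<Rightarrow> nat" (\<open>\<gamma>\<^sub>r\<close>) where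
  "\<gamma>\<^sub>r G = (LEAST k. \<exists>f. weak_roman_dominating G f \<and> weight G f = k)"

definition lex_prod :: "'a pair_pre_digraph \<Rightarrow> 'b pair_pre_digraph \<Rightarrow> ('a \<times> 'b) pair_pre_digraph"
    (infixl \<open>\<circ>\<^sub>L\<close> 75) where
  "G \<circ>\<^sub>L H =
     \<lparr> pverts = pverts G \<times> pverts H,
       parcs = {((u, v), (x, y)) | u v x y.
          u \<in> pverts G \<and> v \<in> pverts H \<and> x \<in> pverts G \<and> y \<in> pverts H \<and>
          (u \<rightarrow>\<^bsub>G\<^esub> x \<or> u = x \<and> v \<rightarrow>\<^bsub>H\<^esub> y)} \<rparr>"

definition double_total_dominating :: "'a pair_pre_digraph \<Rightarrow> 'a set \<Rightarrow> bool" where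
  "double_total_dominating G S \<longleftrightarrow>
     S \<subseteq> pverts G \<and> (\<forall>v\<in>pverts G. 2 \<le> card {u \<in> S. v \<rightarrow>\<^bsub>G\<^esub> u})"

definition double_total_domination_number :: "'a pair_pre_digraph \<Rightarrow> nat" (\<open>\<gamma>\<^sub>2\<^sub>t\<close>) where
  "\<gamma>\<^sub>2\<^sub>t G = (LEAST k. \<exists>S. double_total_dominating G S \<and> card S = k)"


text \<open>
  The product is again a graph, its minimum degree is at least that of \<open>G\<close>, and both domination
  numbers are attained; the second one in particular for the product.
\<close>

lemma pair_graph_lex_prod:
  assumes "pair_graph G" "pair_graph H"
  shows "pair_graph (G \<circ>\<^sub>L H)"
proof -
  interpret G: pair_graph G by fact
  interpret H: pair_graph H by fact
  have fin: "finite (pverts (G \<circ>\<^sub>L H))"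
    by (simp add: lex_prod_def)
  moreover have "parcs (G \<circ>\<^sub>L H) \<subseteq> pverts (G \<circ>\<^sub>L H) \<times> pverts (G \<circ>\<^sub>L H)"
    by (auto simp: lex_prod_def)
  ultimately have "finite (parcs (G \<circ>\<^sub>L H))"
    by (meson finite_SigmaI finite_subset)
  moreover have "sym (parcs (G \<circ>\<^sub>L H))"
    by (auto simp: lex_prod_def sym_def intro: G.arcs_symmetric H.arcs_symmetric)
  ultimately show ?thesis
    using fin
    by unfold_locales
      (auto simp: lex_prod_def symmetric_def dest: G.pair_no_loops H.pair_no_loops)
qed

lemma out_degree_eq_card:
  fixes G :: "'a pair_pre_digraph"
  shows "out_degree G v = card {u. v \<rightarrow>\<^bsub>G\<^esub> u}"
proof -
  have "out_arcs G v = Pair v ` {u. v \<rightarrow>\<^bsub>G\<^esub> u}"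
    by (auto simp: out_arcs_def)
  then show ?thesis
    by (simp add: out_degree_def card_image inj_on_def)
qed

lemma min_degree_le:
  assumes "pair_graph G" "v \<in> pverts G"
  shows "min_degree G \<le> out_degree G v"
proof -
  interpret G: pair_graph G by fact
  show ?thesis
    unfolding min_degree_def using assms(2) by simp
qed

lemma min_degree_lex_prod:
  assumes "pair_graph G" "pair_graph H" "pverts G \<noteq> {}" "pverts H \<noteq> {}"
  shows "min_degree G \<le> min_degree (G \<circ>\<^sub>L H)"
proof -
  interpret G: pair_graph G by fact
  interpret GH: pair_graph "G \<circ>\<^sub>L H" using assms by (simp add: pair_graph_lex_prod)
  have "min_degree G \<le> out_degree (G \<circ>\<^sub>L H) p" if p: "p \<in> pverts (G \<circ>\<^sub>L H)" for p
  proof -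
    obtain a b where ab: "p = (a, b)" "a \<in> pverts G" "b \<in> pverts H"
      using p by (auto simp: lex_prod_def)
    have sub: "(\<lambda>u. (u, b)) ` {u. a \<rightarrow>\<^bsub>G\<^esub> u} \<subseteq> {q. p \<rightarrow>\<^bsub>G \<circ>\<^sub>L H\<^esub> q}"
      using ab by (auto simp: lex_prod_def dest: G.in_arcsD2)
    have fin: "finite {q. p \<rightarrow>\<^bsub>G \<circ>\<^sub>L H\<^esub> q}"
      by (rule finite_subset[of _ "pverts (G \<circ>\<^sub>L H)"]) (auto dest: GH.in_arcsD2)
    have "out_degree G a = card ((\<lambda>u. (u, b)) ` {u. a \<rightarrow>\<^bsub>G\<^esub> u})"
      by (simp add: out_degree_eq_card card_image inj_on_def)
    also have "\<dots> \<le> out_degree (G \<circ>\<^sub>L H) p"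
      unfolding out_degree_eq_card by (rule card_mono[OF fin sub])
    finally show ?thesis using min_degree_le[OF assms(1) ab(2)] by simp
  qed
  moreover have "pverts (G \<circ>\<^sub>L H) \<noteq> {}"
    using assms(3,4) by (auto simp: lex_prod_def)
  ultimately show ?thesis
    unfolding min_degree_def[of "G \<circ>\<^sub>L H"] by (intro Min.boundedI) auto
qed

lemma double_total_dominating_verts:
  assumes "pair_graph G" "2 \<le> min_degree G"
  shows "double_total_dominating G (pverts G)"
proof -
  interpret G: pair_graph G by fact
  have "{u \<in> pverts G. v \<rightarrow>\<^bsub>G\<^esub> u} = {u. v \<rightarrow>\<^bsub>G\<^esub> u}" for v
    by (auto dest: G.in_arcsD2)
  then show ?thesis
    unfolding double_total_dominating_def
    using assms(2) min_degree_le[OF assms(1)] by (simp add: out_degree_eq_card) (meson order_trans)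
qed

lemma double_total_domination_number_attained:
  assumes "pair_graph G" "2 \<le> min_degree G"
  shows "\<exists>S. double_total_dominating G S \<and> card S = \<gamma>\<^sub>2\<^sub>t G"
  unfolding double_total_domination_number_def
  by (rule LeastI[where k = "card (pverts G)"])
    (use double_total_dominating_verts[OF assms] in blast)

lemma weak_roman_domination_number_attained:
  "\<exists>f. weak_roman_dominating G f \<and> weight G f = \<gamma>\<^sub>r G"
proof -
  have "weak_roman_dominating G (\<lambda>_. 1)"
    by (simp add: weak_roman_dominating_def)
  then show ?thesis
    unfolding weak_roman_domination_number_def
    by - (rule LeastI[where k = "weight G (\<lambda>_. 1)"], blast)
qed

end

theory Submission
  imports Defs
begin

text \<open>
  For a double total dominating set \<open>S\<close>, the indicator function of \<open>S\<close> is a WRDF: moving the guard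
  of a single vertex \<open>u\<close> leaves every vertex with a neighbour in \<open>S - {u}\<close>. In the product, any copy
  \<open>S \<times> {h}\<close> of \<open>S\<close> is again double total dominating.
\<close>

text \<open>At least two neighbours of \<open>v\<close> lie in \<open>S\<close>, so one of them
  survives the exclusion of any single vertex \<open>u\<close>. In the application \<open>u\<close>
  is the vertex whose guard has moved away.\<close>

lemma double_total_dominating_neighbour:
  assumes "double_total_dominating G S" "v \<in> pverts G"
  obtains w where "w \<in> S" "w \<noteq> u" "v \<rightarrow>\<^bsub>G\<^esub> w"
proof -
  have "\<not> {w \<in> S. v \<rightarrow>\<^bsub>G\<^esub> w} \<subseteq> {u}"
  proof
    assume "{w \<in> S. v \<rightarrow>\<^bsub>G\<^esub> w} \<subseteq> {u}"
    from card_mono[OF _ this] have "card {w \<in> S. v \<rightarrow>\<^bsub>G\<^esub> w} \<le> 1" by simp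
    with assms show False by (fastforce simp: double_total_dominating_def)
  qed
  with that show thesis by blast
qed

lemma weak_roman_dominating_indicator:
  assumes S: "double_total_dominating G S"
  shows "weak_roman_dominating G (\<lambda>v. of_bool (v \<in> S))"
proof -
  let ?f = "\<lambda>v. of_bool (v \<in> S) :: nat"
  have "\<exists>u. v \<rightarrow>\<^bsub>G\<^esub> u \<and> ?f u \<in> {1, 2} \<and> (\<nexists>z. undefended G (?f(v := 1, u := ?f u - 1)) z)"
    if v: "v \<in> pverts G" for v
  proof -
    obtain u where u: "u \<in> S" "v \<rightarrow>\<^bsub>G\<^esub> u"
      using double_total_dominating_neighbour[OF S v] by blast
    have "\<not> undefended G (?f(v := 1, u := ?f u - 1)) z" for z
    proof
      assume z: "undefended G (?f(v := 1, u := ?f u - 1)) z"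
      then have "z \<in> pverts G" by (simp add: undefended_def)
      then obtain w where "w \<in> S" "w \<noteq> u" "z \<rightarrow>\<^bsub>G\<^esub> w"
        by (rule double_total_dominating_neighbour[OF S])
      \<comment> \<open>As \<open>w\<close> differs from \<open>u\<close>, the modified function has
        value 1 at \<open>w\<close>: either \<open>w = v\<close>, which has just received the guard,
        or \<open>w\<close> keeps its indicator value. So \<open>z\<close> has a neighbour of
        nonzero value.\<close>
      with z show False by (auto simp: undefended_def split: if_splits)
    qed
    with u show ?thesis by auto
  qed
  then show ?thesis by (simp add: weak_roman_dominating_def)
qed

lemma weak_roman_domination_number_le_card:
  assumes "finite (pverts G)" "double_total_dominating G S"
  shows "\<gamma>\<^sub>r G \<le> card S"
proof -
  \<comment> \<open>Summing the indicator over \<open>pverts G\<close> counts only the members of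
    \<open>S\<close> that are vertices; by this equation these are all of \<open>S\<close>.\<close>
  have "pverts G \<inter> S = S"
    using assms(2) by (auto simp: double_total_dominating_def)
  then have "weight G (\<lambda>v. of_bool (v \<in> S)) = card S"
    using assms(1) by (simp add: weight_def of_bool_def sum.If_cases)
  with weak_roman_dominating_indicator[OF assms(2)] show ?thesis
    unfolding weak_roman_domination_number_def by (blast intro: Least_le)
qed

lemma double_total_domination_number_le_card:
  assumes "double_total_dominating G S"
  shows "\<gamma>\<^sub>2\<^sub>t G \<le> card S"
  unfolding double_total_domination_number_def using assms by (blast intro: Least_le)

text \<open>If \<open>u\<close> is adjacent to \<open>a\<close> in \<open>G\<close>, then
  \<open>(u, h)\<close> is adjacent to \<open>(a, b)\<close> for every \<open>b\<close>. Hence the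
  neighbours of \<open>a\<close> in \<open>S\<close> lift injectively to neighbours of
  \<open>(a, b)\<close> in the copy of \<open>S\<close>.\<close>

lemma double_total_dominating_lex_prod:
  assumes fin: "finite S" and S: "double_total_dominating G S" and h: "h \<in> pverts H"
  shows "double_total_dominating (G \<circ>\<^sub>L H) (S \<times> {h})"
proof -
  have SG: "S \<subseteq> pverts G"
    using S by (simp add: double_total_dominating_def)
  have "2 \<le> card {q \<in> S \<times> {h}. (a, b) \<rightarrow>\<^bsub>G \<circ>\<^sub>L H\<^esub> q}"
    if a: "a \<in> pverts G" and b: "b \<in> pverts H" for a b
  proof -
    have 2: "2 \<le> card {u \<in> S. a \<rightarrow>\<^bsub>G\<^esub> u}"
      using S a by (simp add: double_total_dominating_def)
    have "{q \<in> S \<times> {h}. (a, b) \<rightarrow>\<^bsub>G \<circ>\<^sub>L H\<^esub> q} \<supseteq> (\<lambda>u. (u, h)) ` {u \<in> S. a \<rightarrow>\<^bsub>G\<^esub> u}"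
      using SG h a b by (auto simp: lex_prod_def)
    moreover have "finite {q \<in> S \<times> {h}. (a, b) \<rightarrow>\<^bsub>G \<circ>\<^sub>L H\<^esub> q}"
      using fin by simp
    ultimately have "card ((\<lambda>u. (u, h)) ` {u \<in> S. a \<rightarrow>\<^bsub>G\<^esub> u}) \<le> card {q \<in> S \<times> {h}. (a, b) \<rightarrow>\<^bsub>G \<circ>\<^sub>L H\<^esub> q}"
      by (intro card_mono)
    with 2 show ?thesis by (simp add: card_image inj_on_def)
  qed
  with SG h show ?thesis
    by (auto simp: double_total_dominating_def lex_prod_def)
qed

text \<open>The inequality on cardinalities accommodates the null graph \<open>H\<close>: there is
  then no layer to hold a copy of \<open>S\<close>, but the product has no vertices and the empty
  set serves.\<close>

lemma double_total_dominating_lex_prod_card_le: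
  assumes "finite S" "double_total_dominating G S"
  obtains T where "double_total_dominating (G \<circ>\<^sub>L H) T" "card T \<le> card S"
proof (cases "pverts H = {}")
  case True
  then have "double_total_dominating (G \<circ>\<^sub>L H) {}"
    by (simp add: double_total_dominating_def lex_prod_def)
  then show thesis by (rule that) simp
next
  case False
  then obtain h where "h \<in> pverts H" by blast
  then have "double_total_dominating (G \<circ>\<^sub>L H) (S \<times> {h})"
    by (rule double_total_dominating_lex_prod[OF assms])
  then show thesis by (rule that) (simp add: card_cartesian_product)
qed

theorem theorem19:
  fixes G :: "'a pair_pre_digraph"
  assumes "pair_graph G"
    and "2 \<le> min_degree G"
  shows "\<gamma>\<^sub>r G \<le> \<gamma>\<^sub>2\<^sub>t G
    \<and> (\<forall>H :: 'b pair_pre_digraph. pair_graph H \<longrightarrow> \<gamma>\<^sub>2\<^sub>t (G \<circ>\<^sub>L H) \<le> \<gamma>\<^sub>2\<^sub>t G)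
    \<and> (\<forall>H :: 'b pair_pre_digraph. pair_graph H \<longrightarrow> \<gamma>\<^sub>r (G \<circ>\<^sub>L H) \<le> \<gamma>\<^sub>2\<^sub>t G)"
proof -
  interpret G: pair_graph G by fact
  obtain S where S: "double_total_dominating G S" "card S = \<gamma>\<^sub>2\<^sub>t G"
    using double_total_domination_number_attained[OF assms] by blast
  have finS: "finite S"
    using S(1) by (auto simp: double_total_dominating_def intro: finite_subset)
  have "\<gamma>\<^sub>r G \<le> \<gamma>\<^sub>2\<^sub>t G"
    using weak_roman_domination_number_le_card[OF _ S(1)] S(2) by simp
  moreover have "\<gamma>\<^sub>2\<^sub>t (G \<circ>\<^sub>L H) \<le> \<gamma>\<^sub>2\<^sub>t G \<and> \<gamma>\<^sub>r (G \<circ>\<^sub>L H) \<le> \<gamma>\<^sub>2\<^sub>t G"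
    if "pair_graph H" for H :: "'b pair_pre_digraph"
  proof -
    interpret H: pair_graph H by fact
    have fin: "finite (pverts (G \<circ>\<^sub>L H))" by (simp add: lex_prod_def)
    obtain T where T: "double_total_dominating (G \<circ>\<^sub>L H) T" "card T \<le> card S"
      using double_total_dominating_lex_prod_card_le[OF finS S(1)] .
    show ?thesis
      \<comment> \<open>The same \<open>T\<close> bounds both numbers of the product. Working with
        \<open>T\<close> itself avoids any appeal to the minimum degree of the product, which is
        unspecified when \<open>H\<close> is null.\<close>
      using double_total_domination_number_le_card[OF T(1)]
        weak_roman_domination_number_le_card[OF fin T(1)] T(2) S(2) by simp
  qed
  ultimately show ?thesis by blast
qed

end
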